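(* Let $s\ge1$ and $n\ge1$ be integers, let $p,q\in(0,1)$ satisfy $\sum_{k=0}^{s}p^kq^{s-k}=1$, and let $X\sim\mathcal{B}^{(s)}(n,p)$ follow the bi$^s$nomial distribution. Let $G_X(t)=E(t^X)$ be the probability generating function of $X$, and let $G_{X_1}$ be that of an $s$-Bernoulli variable $X_1\sim\mathcal{B}^{(s)}(p)$. Then $G_X=(G_{X_1})^n$; explicitly, if $p\neq q$, $$G_X(t)=\left(\frac{q^{s+1}-(pt)^{s+1}}{q-pt}\right)^n=\sum_{k=0}^{sn}\binom{n}{k}_s(pt)^kq^{sn-k}\qquad\text{for all real }t\text{ with }pt\ne q,$$ and, if $p=q$, $$G_X(t)=\frac{1}{(s+1)^n}\left(\frac{1-t^{s+1}}{1-t}\right)^n=\frac{1}{(s+1)^n}\sum_{k=0}^{sn}\binom{n}{k}_st^k\qquad\text{for all real }t\neq1.$$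
   Context: For integers $n\ge 1$, $s\ge1$, $k\ge0$, the bi$^s$nomial coefficient $\binom{n}{k}_s$ is the number of integer solutions $(x_1,\dots,x_n)$ of $x_1+\cdots+x_n=k$ with $0\le x_i\le s$ for all $i$. Let $p,q\in(0,1)$ satisfy $\sum_{k=0}^s p^kq^{s-k}=1$. The $s$-Bernoulli distribution $\mathcal{B}^{(s)}(p)$ is the law on $\{0,1,\dots,s\}$ with $\mathbb{P}(X_1=k)=p^kq^{s-k}$. The bi$^s$nomial distribution $\mathcal{B}^{(s)}(n,p)$ is the law of the sum of $n$ independent $\mathcal{B}^{(s)}(p)$ variables; it is the law on $\{0,\dots,sn\}$ with $\mathbb{P}(X=k)=\binom{n}{k}_s p^kq^{sn-k}$. *)

theory Defs
  imports "HOL-Probability.Probability"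
begin

definition bisnomial :: "nat \<Rightarrow> nat \<Rightarrow> nat \<Rightarrow> nat" where
  "bisnomial s n k = card {x \<in> {1..n} \<rightarrow>\<^sub>E {0..s}. (\<Sum>i=1..n. x i) = k}"

(* The parameter q is determined by p through the normalisation condition; it is kept as an
   explicit argument.  Outside that condition the value of embed_pmf is unspecified. *)
definition s_bernoulli_pmf :: "nat \<Rightarrow> real \<Rightarrow> real \<Rightarrow> nat pmf" where
  "s_bernoulli_pmf s p q = embed_pmf (\<lambda>k. if k \<le> s then p ^ k * q ^ (s - k) else 0)"

(* The law of the sum of n independent s-Bernoulli variables.  Pi_pmf is the product law; its
   second argument is only the value taken by a family outside the index set. *)
definition bisnomial_pmf :: "nat \<Rightarrow> nat \<Rightarrow> real \<Rightarrow> real \<Rightarrow> nat pmf" where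
  "bisnomial_pmf s n p q =
     map_pmf (\<lambda>x. \<Sum>i=1..n. x i) (Pi_pmf {1..n} undefined (\<lambda>_. s_bernoulli_pmf s p q))"

(* The laws above have finite support when the normalisation holds, so the integrand is
   integrable for every real t.  Note 0 ^ 0 = 1. *)
definition pgf :: "'a measure \<Rightarrow> ('a \<Rightarrow> nat) \<Rightarrow> real \<Rightarrow> real" where
  "pgf M X t = (\<integral>\<omega>. t ^ X \<omega> \<partial>M)"

lemma pmf_s_bernoulli:
  assumes "0 < p" "0 < q" "(\<Sum>k=0..s. p ^ k * q ^ (s - k)) = 1"
  shows "pmf (s_bernoulli_pmf s p q) k = (if k \<le> s then p ^ k * q ^ (s - k) else 0)"
  unfolding s_bernoulli_pmf_def
proof (rule pmf_embed_pmf)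
  let ?f = "\<lambda>k. if k \<le> s then p ^ k * q ^ (s - k) else 0"
  show "0 \<le> ?f x" for x using assms by simp
  have "(\<integral>\<^sup>+x. ennreal (?f x) \<partial>count_space UNIV) = (\<Sum>x\<in>{0..s}. ennreal (?f x))"
    by (rule nn_integral_count_space') auto
  also have "\<dots> = ennreal (\<Sum>x\<in>{0..s}. ?f x)"
    using assms by (intro sum_ennreal) simp
  also have "(\<Sum>x\<in>{0..s}. ?f x) = 1"
    using assms(3) by simp
  finally show "(\<integral>\<^sup>+x. ennreal (?f x) \<partial>count_space UNIV) = 1" by simp
qed

lemma pmf_bisnomial:
  assumes "0 < p" "0 < q" "(\<Sum>k=0..s. p ^ k * q ^ (s - k)) = 1"
  shows "pmf (bisnomial_pmf s n p q) k = real (bisnomial s n k) * p ^ k * q ^ (s * n - k)"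
proof -
  let ?P = "Pi_pmf {1..n} undefined (\<lambda>_. s_bernoulli_pmf s p q)"
  let ?S = "{x \<in> {1..n} \<rightarrow>\<^sub>E {0..s}. (\<Sum>i=1..n. x i) = k}"
  have "set_pmf (s_bernoulli_pmf s p q) \<subseteq> {0..s}"
    using pmf_s_bernoulli[OF assms] by (auto simp: set_pmf_eq split: if_splits)
  then have supp: "set_pmf ?P \<subseteq> {1..n} \<rightarrow>\<^sub>E {0..s}"
    by (auto simp: set_Pi_pmf PiE_dflt_def PiE_def extensional_def)
  have "pmf (bisnomial_pmf s n p q) k = measure ?P {x. (\<Sum>i=1..n. x i) = k}"
    by (simp add: bisnomial_pmf_def pmf_map vimage_def)
  also have "\<dots> = measure ?P ?S"
    using supp by (intro measure_pmf.finite_measure_eq_AE) (auto simp: AE_measure_pmf_iff)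
  also have "\<dots> = (\<Sum>x\<in>?S. pmf ?P x)"
    by (rule measure_measure_pmf_finite) (simp add: finite_PiE)
  also have "\<dots> = (\<Sum>x\<in>?S. p ^ k * q ^ (s * n - k))"
  proof (rule sum.cong[OF refl])
    fix x assume x: "x \<in> ?S"
    then have le: "x i \<le> s" if "i \<in> {1..n}" for i using that by (auto simp: PiE_def Pi_def)
    have "pmf ?P x = (\<Prod>i\<in>{1..n}. pmf (s_bernoulli_pmf s p q) (x i))"
      using x by (intro pmf_Pi') (auto simp: PiE_def extensional_def)
    also have "\<dots> = (\<Prod>i\<in>{1..n}. p ^ x i * q ^ (s - x i))"
      using le by (intro prod.cong) (auto simp: pmf_s_bernoulli[OF assms])
    also have "\<dots> = p ^ (\<Sum>i=1..n. x i) * q ^ (\<Sum>i=1..n. s - x i)"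
      by (simp add: prod.distrib power_sum)
    also have "(\<Sum>i=1..n. s - x i) = s * n - (\<Sum>i=1..n. x i)"
      using le by (subst sum_subtractf_nat) (auto simp: mult.commute)
    finally show "pmf ?P x = p ^ k * q ^ (s * n - k)" using x by simp
  qed
  also have "\<dots> = real (bisnomial s n k) * p ^ k * q ^ (s * n - k)"
    by (simp add: bisnomial_def)
  finally show ?thesis .
qed

end

theory Submission
  imports Defs
begin

text \<open>Everything reduces to the multinomial-type identity
  \<open>(\<Sum>k\<le>s. a^k b^(s-k))^n = \<Sum>k. bisnomial s n k * a^k * b^(sn-k)\<close>: expanding the product over functions
  \<open>{1..n} \<rightarrow> {0..s}\<close> and collecting them by their sum gives the coefficients. With \<open>a = pt\<close>, \<open>b = q\<close> its two
  sides are the two generating functions. For \<open>p = q\<close> the normalisation says \<open>p^s = 1 / (s + 1)\<close>.\<close>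

lemma sum_PiE_le:
  fixes x :: "nat \<Rightarrow> nat"
  assumes "x \<in> {1..n} \<rightarrow>\<^sub>E {0..s}"
  shows "(\<Sum>i=1..n. x i) \<le> s * n"
  using sum_bounded_above[of "{1..n}" x s] assms by (auto simp: PiE_iff mult.commute)

text \<open>For \<open>k > s * n\<close> the truncated exponent \<open>s * n - k\<close> is 0, so in
  \<open>pmf_bisnomial\<close> only the coefficient can make the mass vanish. This confines the
  support to \<open>{0..s * n}\<close>.\<close>

lemma bisnomial_eq_0:
  assumes "k > s * n"
  shows "bisnomial s n k = 0"
proof -
  have "(\<Sum>i=1..n. x i) \<noteq> k" if "x \<in> {1..n} \<rightarrow>\<^sub>E {0..s}" for x
    using sum_PiE_le[OF that] assms by linarith
  then have "{x \<in> {1..n} \<rightarrow>\<^sub>E {0..s}. (\<Sum>i=1..n. x i) = k} = {}"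
    by blast
  then show ?thesis unfolding bisnomial_def by (simp only: card.empty)
qed

lemma homogeneous_sum_power:
  fixes a b :: "'a::comm_semiring_1"
  shows "(\<Sum>k=0..s. a ^ k * b ^ (s - k)) ^ n
    = (\<Sum>k=0..s * n. of_nat (bisnomial s n k) * a ^ k * b ^ (s * n - k))"
proof -
  let ?F = "{1..n} \<rightarrow>\<^sub>E {0..s}"
  let ?S = "\<lambda>x::nat \<Rightarrow> nat. \<Sum>i=1..n. x i"
  have fin: "finite ?F" by (simp add: finite_PiE)
  have "(\<Sum>k=0..s. a ^ k * b ^ (s - k)) ^ n = (\<Prod>i=1..n. \<Sum>k\<in>{0..s}. a ^ k * b ^ (s - k))"
    by simp
  also have "\<dots> = (\<Sum>x\<in>?F. \<Prod>i=1..n. a ^ x i * b ^ (s - x i))"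
    by (rule prod_sum_PiE) auto
  also have "\<dots> = (\<Sum>x\<in>?F. a ^ ?S x * b ^ (s * n - ?S x))"
  proof (rule sum.cong[OF refl])
    fix x assume x: "x \<in> ?F"
    \<comment> \<open>Truncated subtraction is exact here because every \<open>x i\<close> is at
      most \<open>s\<close>.\<close>
    have "(\<Sum>i=1..n. s - x i) = s * n - ?S x"
      using x by (subst sum_subtractf_nat) (auto simp: PiE_iff mult.commute)
    then show "(\<Prod>i=1..n. a ^ x i * b ^ (s - x i)) = a ^ ?S x * b ^ (s * n - ?S x)"
      by (simp add: prod.distrib flip: power_sum)
  qed
  \<comment> \<open>By \<open>sum_PiE_le\<close> each function lies in exactly one class. The
    summand is constant on a class, whose size is the coefficient.\<close>
  also have "\<dots> = (\<Sum>k\<in>{0..s * n}. \<Sum>x\<in>{x \<in> ?F. ?S x = k}. a ^ ?S x * b ^ (s * n - ?S x))"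
    by (rule sum.group[symmetric]) (use fin sum_PiE_le in auto)
  also have "\<dots> = (\<Sum>k=0..s * n. of_nat (bisnomial s n k) * a ^ k * b ^ (s * n - k))"
    by (simp add: bisnomial_def mult.assoc)
  finally show ?thesis .
qed

text \<open>The geometric sum in homogeneous form, from the factorisation of a difference of powers.
  It is applied with \<open>b = q\<close> and with \<open>b = 1\<close>.\<close>

lemma homogeneous_sum_eq_divide:
  fixes a b :: "'a::field"
  assumes "a \<noteq> b"
  shows "(\<Sum>k=0..s. a ^ k * b ^ (s - k)) = (b ^ (s + 1) - a ^ (s + 1)) / (b - a)"
proof -
  have "a ^ (s + 1) - b ^ (s + 1) = (a - b) * (\<Sum>k=0..s. a ^ k * b ^ (s - k))"
    using diff_power_eq_sum[of a s b] by (simp add: atLeast0AtMost lessThan_Suc_atMost)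
  then show ?thesis using assms by (simp add: field_simps)
qed

text \<open>The generating function depends only on the law, by change of variables. A law carried
  by a finite set turns the integral into a finite sum, whatever the real \<open>t\<close>.\<close>

lemma pgf_eq_sum:
  assumes X: "X \<in> measurable M (count_space UNIV)"
    and distr: "distr M (count_space UNIV) X = measure_pmf D"
    and "finite A" and supp: "\<And>k. k \<notin> A \<Longrightarrow> pmf D k = 0"
  shows "pgf M X t = (\<Sum>k\<in>A. pmf D k * t ^ k)"
proof -
  have "pgf M X t = (\<integral>k. t ^ k \<partial>distr M (count_space UNIV) X)"
    unfolding pgf_def by (rule integral_distr[symmetric]) (use X in auto)
  also have "\<dots> = (\<Sum>k\<in>A. t ^ k * pmf D k)"
    unfolding distr using \<open>finite A\<close> supp by (intro integral_measure_pmf_real) (auto simp: set_pmf_eq)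
  finally show ?thesis by (simp only: mult.commute)
qed

theorem theorem4p1:
  fixes s n :: nat and p q :: real
    and M :: "'a measure" and X :: "'a \<Rightarrow> nat"
    and N :: "'b measure" and X1 :: "'b \<Rightarrow> nat"
  assumes "s \<ge> 1" and "n \<ge> 1"
    and "0 < p" and "p < 1" and "0 < q" and "q < 1"
    and "(\<Sum>k=0..s. p ^ k * q ^ (s - k)) = 1"
    and "prob_space M" and "X \<in> measurable M (count_space UNIV)"
    and "distr M (count_space UNIV) X = measure_pmf (bisnomial_pmf s n p q)"
    and "prob_space N" and "X1 \<in> measurable N (count_space UNIV)"
    and "distr N (count_space UNIV) X1 = measure_pmf (s_bernoulli_pmf s p q)"
  shows "(\<forall>t. pgf M X t = (pgf N X1 t) ^ n) \<and>
    (p \<noteq> q \<longrightarrow> (\<forall>t. p * t \<noteq> q \<longrightarrow>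
       pgf M X t = ((q ^ (s + 1) - (p * t) ^ (s + 1)) / (q - p * t)) ^ n \<and>
       ((q ^ (s + 1) - (p * t) ^ (s + 1)) / (q - p * t)) ^ n
         = (\<Sum>k=0..s * n. real (bisnomial s n k) * (p * t) ^ k * q ^ (s * n - k)))) \<and>
    (p = q \<longrightarrow> (\<forall>t. t \<noteq> 1 \<longrightarrow>
       pgf M X t = 1 / (real s + 1) ^ n * ((1 - t ^ (s + 1)) / (1 - t)) ^ n \<and>
       1 / (real s + 1) ^ n * ((1 - t ^ (s + 1)) / (1 - t)) ^ n
         = 1 / (real s + 1) ^ n * (\<Sum>k=0..s * n. real (bisnomial s n k) * t ^ k)))"
proof -
  note pq = \<open>0 < p\<close> \<open>0 < q\<close> \<open>(\<Sum>k=0..s. p ^ k * q ^ (s - k)) = 1\<close>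
  have G1: "pgf N X1 t = (\<Sum>k=0..s. (p * t) ^ k * q ^ (s - k))" for t
    by (subst pgf_eq_sum[OF assms(12,13), of "{0..s}"])
      (auto simp: pmf_s_bernoulli[OF pq] power_mult_distrib intro!: sum.cong)
  have G: "pgf M X t = (\<Sum>k=0..s * n. real (bisnomial s n k) * (p * t) ^ k * q ^ (s * n - k))" for t
    by (subst pgf_eq_sum[OF assms(9,10), of "{0..s * n}"])
      (auto simp: pmf_bisnomial[OF pq] bisnomial_eq_0 power_mult_distrib intro!: sum.cong)
  \<comment> \<open>Only the polynomial forms are compared, so the points with
    \<open>p * t = q\<close> are covered too.\<close>
  have GG1: "pgf M X t = pgf N X1 t ^ n" for t
    unfolding G G1 homogeneous_sum_power by simp
  \<comment> \<open>The factor \<open>1 ^ (s - k)\<close> is kept so that the sum is literally the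
    homogeneous one with \<open>a = t\<close> and \<open>b = 1\<close>.\<close>
  have G1_eq: "pgf N X1 t = 1 / (real s + 1) * (\<Sum>k=0..s. t ^ k * 1 ^ (s - k))" if "p = q" for t
  proof -
    have pow: "p ^ k * p ^ (s - k) = p ^ s" if "k \<le> s" for k
      using that by (simp flip: power_add)
    \<comment> \<open>All \<open>s + 1\<close> terms of the normalisation equal
      \<open>p ^ s\<close>.\<close>
    have "(real s + 1) * p ^ s = 1"
      using pq(3) \<open>p = q\<close> pow by (simp add: algebra_simps)
    then have ps: "p ^ s = 1 / (real s + 1)" by (simp add: field_simps)
    have "pgf N X1 t = (\<Sum>k=0..s. p ^ s * t ^ k)"
      unfolding G1 using pow \<open>p = q\<close>
      by (intro sum.cong) (auto simp: power_mult_distrib mult.commute mult.left_commute)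
    then show ?thesis by (simp add: ps sum_divide_distrib)
  qed
  have neq: "pgf M X t = ((q ^ (s + 1) - (p * t) ^ (s + 1)) / (q - p * t)) ^ n" if "p * t \<noteq> q" for t
    unfolding GG1 G1 homogeneous_sum_eq_divide[OF that] ..
  have eq: "pgf M X t = 1 / (real s + 1) ^ n * ((1 - t ^ (s + 1)) / (1 - t)) ^ n"
    if "p = q" "t \<noteq> 1" for t
    unfolding GG1 G1_eq[OF that(1)] homogeneous_sum_eq_divide[OF that(2)]
    by (simp add: power_mult_distrib power_divide)
  have sum: "((1 - t ^ (s + 1)) / (1 - t)) ^ n = (\<Sum>k=0..s * n. real (bisnomial s n k) * t ^ k)"
    if "t \<noteq> 1" for t :: real
    using homogeneous_sum_power[of t 1 s n] unfolding homogeneous_sum_eq_divide[OF that] by simp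
  show ?thesis
  proof (intro conjI allI impI)
    show "pgf M X t = pgf N X1 t ^ n" for t by (rule GG1)
  next
    fix t assume t: "p * t \<noteq> q"
    show "pgf M X t = ((q ^ (s + 1) - (p * t) ^ (s + 1)) / (q - p * t)) ^ n"
      by (rule neq[OF t])
    \<comment> \<open>Both sides have already been identified with \<open>pgf M X t\<close>.\<close>
    then show "((q ^ (s + 1) - (p * t) ^ (s + 1)) / (q - p * t)) ^ n
        = (\<Sum>k=0..s * n. real (bisnomial s n k) * (p * t) ^ k * q ^ (s * n - k))"
      using G by (rule trans[OF sym])
  next
    fix t :: real assume "p = q" and t: "t \<noteq> 1"
    then show "pgf M X t = 1 / (real s + 1) ^ n * ((1 - t ^ (s + 1)) / (1 - t)) ^ n"
      by (rule eq)
    show "1 / (real s + 1) ^ n * ((1 - t ^ (s + 1)) / (1 - t)) ^ n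
        = 1 / (real s + 1) ^ n * (\<Sum>k=0..s * n. real (bisnomial s n k) * t ^ k)"
      unfolding sum[OF t] ..
  qed
qed

end
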